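(* Let $(X,d)$ be a metric space. Then the following are equivalent. (a) $(X,d)$ is cofinally complete. (b) For every metric space $(Y,\rho)$ and every continuous function $f:(X,d)\to(Y,\rho)$, $f$ is strongly uniformly continuous on each member of $AC(X)$. (c) For every metric space $(Y,\rho)$ and every continuous function $f:(X,d)\to(Y,\rho)$, $D_d(A,B)=0$ implies $D_\rho(f(A),f(B))=0$ whenever $A\in AC(X)$ and $B$ is a non-empty subset of $X$.
   Context: A sequence $(x_n)$ in a metric space $(X,d)$ is cofinally Cauchy if for every $\epsilon>0$ there exists an infinite subset $\mathbb{N}_\epsilon$ of $\mathbb{N}$ such that $d(x_n,x_j)<\epsilon$ for all $n,j\in\mathbb{N}_\epsilon$. The space $(X,d)$ is cofinally complete if every cofinally Cauchy sequence in $X$ has a cluster point in $X$. The local compactness functional $\nu$ on $X$ is defined by $\nu(x)=\sup\{\epsilon>0:\ \overline{B_d(x,\epsilon)}\text{ is compact}\}$ if $x$ has a compact neighborhood, and $\nu(x)=0$ otherwise, where $B_d(x,\epsilon)$ is the open ball and the bar denotes closure (so $\nu(x)$ may be $+\infty$). A non-empty closed subset $A$ of $X$ is almost nowhere locally compact if for every $\epsilon>0$ the set $\{a\in A:\nu(a)\ge\epsilon\}$ is compact. $AC(X)$ denotes the set of almost nowhere locally compact subsets of $X$. A function $f:(X,d)\to(Y,\rho)$ is strongly uniformly continuous on $B\subseteq X$ if for every $\epsilon>0$ there exists $\delta>0$ such that if $x,y\in X$, $d(x,y)<\delta$ and $\{x,y\}\cap B\neq\emptyset$, then $\rho(f(x),f(y))<\epsilon$.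 For non-empty subsets $A,B$ of a metric space $(X,d)$, $D_d(A,B)=\inf\{d(a,b):a\in A,\ b\in B\}$; similarly $D_\rho$ in $(Y,\rho)$. *)

theory Defs
  imports "HOL-Analysis.Analysis"
begin

definition cofinally_Cauchy :: "'a metric \<Rightarrow> (nat \<Rightarrow> 'a) \<Rightarrow> bool" where
  "cofinally_Cauchy X \<sigma> \<longleftrightarrow> range \<sigma> \<subseteq> mspace X \<and>
     (\<forall>\<epsilon>>0. \<exists>N. infinite N \<and> (\<forall>n\<in>N. \<forall>j\<in>N. mdist X (\<sigma> n) (\<sigma> j) < \<epsilon>))"

definition cluster_point_of_seq :: "'a topology \<Rightarrow> (nat \<Rightarrow> 'a) \<Rightarrow> 'a \<Rightarrow> bool" where
  "cluster_point_of_seq T \<sigma> x \<longleftrightarrow> x \<in> topspace T \<and>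
     (\<forall>U. openin T U \<and> x \<in> U \<longrightarrow> (\<exists>\<^sub>F n in sequentially. \<sigma> n \<in> U))"

definition cofinally_complete :: "'a metric \<Rightarrow> bool" where
  "cofinally_complete X \<longleftrightarrow>
     (\<forall>\<sigma>. cofinally_Cauchy X \<sigma> \<longrightarrow> (\<exists>x. cluster_point_of_seq (mtopology_of X) \<sigma> x))"

(* Extended-real valued: the supremum is infinite if the closures of all balls around x are
   compact.  The case distinction is needed because the supremum of the empty set is
   minus infinity in ereal. *)
definition local_compactness :: "'a metric \<Rightarrow> 'a \<Rightarrow> ereal" where
  "local_compactness X x =
     (if \<exists>U K. openin (mtopology_of X) U \<and> x \<in> U \<and> U \<subseteq> K \<and> compactin (mtopology_of X) K
      then Sup {ereal \<epsilon> | \<epsilon>. \<epsilon> > 0 \<and>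
                 compactin (mtopology_of X) (mtopology_of X closure_of mball_of X x \<epsilon>)}
      else 0)"

definition AC :: "'a metric \<Rightarrow> 'a set set" where
  "AC X = {A. closedin (mtopology_of X) A \<and> A \<noteq> {} \<and>
     (\<forall>\<epsilon>::real. \<epsilon> > 0 \<longrightarrow> compactin (mtopology_of X) {a \<in> A. local_compactness X a \<ge> ereal \<epsilon>})}"

definition strongly_uniformly_continuous_on ::
    "'a metric \<Rightarrow> 'b metric \<Rightarrow> ('a \<Rightarrow> 'b) \<Rightarrow> 'a set \<Rightarrow> bool" where
  "strongly_uniformly_continuous_on X Y f B \<longleftrightarrow>
     (\<forall>\<epsilon>>0. \<exists>\<delta>>0. \<forall>x\<in>mspace X. \<forall>y\<in>mspace X.
        mdist X x y < \<delta> \<and> {x, y} \<inter> B \<noteq> {} \<longrightarrow> mdist Y (f x) (f y) < \<epsilon>)"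

(* Only meaningful for non-empty subsets of the space. *)
definition mgap :: "'a metric \<Rightarrow> 'a set \<Rightarrow> 'a set \<Rightarrow> real" where
  "mgap X A B = Inf {mdist X a b | a b. a \<in> A \<and> b \<in> B}"

definition continuous_strongly_uniform_on_AC :: "'a metric \<Rightarrow> 'b metric \<Rightarrow> bool" where
  "continuous_strongly_uniform_on_AC X Y \<longleftrightarrow>
     (\<forall>f. continuous_map (mtopology_of X) (mtopology_of Y) f \<longrightarrow>
        (\<forall>A\<in>AC X. strongly_uniformly_continuous_on X Y f A))"

definition continuous_preserves_nearness_to_AC :: "'a metric \<Rightarrow> 'b metric \<Rightarrow> bool" where
  "continuous_preserves_nearness_to_AC X Y \<longleftrightarrow>
     (\<forall>f. continuous_map (mtopology_of X) (mtopology_of Y) f \<longrightarrow>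
        (\<forall>A\<in>AC X. \<forall>B. B \<noteq> {} \<and> B \<subseteq> mspace X \<longrightarrow>
           mgap X A B = 0 \<longrightarrow> mgap Y (f ` A) (f ` B) = 0))"

(* HOL cannot quantify over types inside a formula, so "for every metric space Y" is read as
   "for every metric space Y with points in the type 'b", where the type variable 'b is
   arbitrary except that it must have room for the points of X.  Without that requirement
   the universal statements would be too weak to imply cofinal completeness (consider the
   one-point type).  Every metric space over any type is isometric to one over a type that
   meets the requirement, e.g. over a disjoint sum with the type of X. *)
definition hosts_points_of :: "'b itself \<Rightarrow> 'a metric \<Rightarrow> bool" where
  "hosts_points_of _ X \<longleftrightarrow> (\<exists>\<iota> :: 'a \<Rightarrow> 'b. inj_on \<iota> (mspace X))"

end

theory Submission
  imports Defs
begin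

text \<open>
  Cofinal completeness is a statement about the local compactness functional: it forces every
  sequence along which the functional tends to \<open>0\<close> to cluster. Indeed, if the functional is below
  \<open>1/n\<close> at \<open>x n\<close>, the closure of the ball of radius \<open>1/n\<close> around \<open>x n\<close> is not compact and contains a
  sequence without cluster points. Listing all these sequences, one row for each \<open>n\<close>, as a single
  sequence gives a cofinally Cauchy sequence, since every row is infinite and the rows have diameters
  tending to \<open>0\<close>. A cluster point of it cannot come from finitely many rows, so it is approached
  by rows with larger and larger \<open>n\<close>, hence by their centres \<open>x n\<close>
  (\<open>cluster_point_if_local_compactness_vanishes\<close>).

  From (a) to (b): if a continuous \<open>f\<close> fails to be strongly uniformly continuous on \<open>A\<close>, there are
  pairs of points \<open>x n \<in> A\<close> and \<open>y n\<close> with distance tending to \<open>0\<close> whose images stay \<open>\<epsilon>\<close> apart.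
  If the functional stays away from \<open>0\<close> along suitable such pairs, the \<open>x n\<close> lie in a compact part of
  \<open>A\<close>; otherwise it can be made to tend to \<open>0\<close>. Either way \<open>x\<close> clusters, against the continuity of
  \<open>f\<close> at the cluster point. That (b) implies (c) is immediate.

  From (c) to (a), by contraposition: a cofinally Cauchy sequence without cluster points has a closed
  discrete range that contains infinite pieces of arbitrarily small diameter. A point of a piece of
  diameter below \<open>1/n\<close> has functional at most \<open>1/n\<close>. Taking two points from the \<open>n\<close>-th piece, all
  chosen points being distinct, yields disjoint closed sets \<open>A\<close>, \<open>B\<close> at distance \<open>0\<close> with
  \<open>A\<close> in \<open>AC X\<close> (\<open>AC_witness_if_not_cofinally_complete\<close>). An Urysohn function \<open>f\<close>
  separates \<open>A\<close> from \<open>B\<close>. The real line need not fit into the given type of points, so \<open>f\<close> itself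
  may not be an admissible test function; instead it is added to the metric, and the identity from
  the metric \<open>d(x, y)\<close> to the metric \<open>d(x, y) + \<bar>f x - f y\<bar>\<close>, transported
  along an injection into that type, is the continuous map that keeps \<open>A\<close> and \<open>B\<close> apart
  (\<open>separating_remetrization\<close>).
\<close>

section \<open>Cluster points, limit points and continuity in terms of balls\<close>

lemma cluster_point_of_seq_iff_infinite:
  "cluster_point_of_seq (mtopology_of X) \<sigma> p \<longleftrightarrow>
     p \<in> mspace X \<and> (\<forall>r>0. infinite {n. \<sigma> n \<in> mball_of X p r})"
proof -
  interpret Metric_space "mspace X" "mdist X" by simp
  have *: "(\<exists>\<^sub>F n in sequentially. \<sigma> n \<in> U) \<longleftrightarrow> infinite {n. \<sigma> n \<in> U}" for U
    by (simp add: frequently_cofinite flip: cofinite_eq_sequentially)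
  show ?thesis
    unfolding cluster_point_of_seq_def * topspace_mtopology_of
  proof (intro conj_cong refl iffI allI impI)
    fix r :: real
    assume "\<forall>U. openin (mtopology_of X) U \<and> p \<in> U \<longrightarrow> infinite {n. \<sigma> n \<in> U}" "0 < r"
      "p \<in> mspace X"
    moreover have "openin (mtopology_of X) (mball_of X p r)"
      by (simp add: mball_of_def mtopology_of_def)
    moreover have "p \<in> mball_of X p r" using \<open>0 < r\<close> \<open>p \<in> mspace X\<close> by simp
    ultimately show "infinite {n. \<sigma> n \<in> mball_of X p r}" by blast
  next
    fix U assume a: "\<forall>r>0. infinite {n. \<sigma> n \<in> mball_of X p r}" 
      and U: "openin (mtopology_of X) U \<and> p \<in> U"
    obtain r where "r > 0" "mball p r \<subseteq> U"
      using U by (auto simp: mtopology_of_def openin_mtopology)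
    then have "{n. \<sigma> n \<in> mball_of X p r} \<subseteq> {n. \<sigma> n \<in> U}" 
      by (auto simp: mball_of_def)
    then show "infinite {n. \<sigma> n \<in> U}"
      using a \<open>r > 0\<close> infinite_super by blast
  qed
qed

lemma derived_set_of_mtopology_of:
  "mtopology_of X derived_set_of S = {p \<in> mspace X. \<forall>r>0. infinite (S \<inter> mball_of X p r)}"
proof -
  interpret Metric_space "mspace X" "mdist X" by simp
  show ?thesis by (simp add: mtopology_of_def mball_of_def derived_set_of_infinite_mball)
qed

lemma continuous_map_mtopology_of_iff:
  "continuous_map (mtopology_of X) (mtopology_of Y) f \<longleftrightarrow>
     f \<in> mspace X \<rightarrow> mspace Y \<and>
     (\<forall>a\<in>mspace X. \<forall>\<epsilon>>0. \<exists>\<delta>>0. \<forall>x\<in>mspace X. mdist X a x < \<delta> \<longrightarrow> mdist Y (f a) (f x) < \<epsilon>)"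
proof -
  interpret Metric_space "mspace X" "mdist X" by simp
  show ?thesis
    unfolding mtopology_of_def metric_continuous_map[OF Metric_space_mspace_mdist]
    by (simp add: image_subset_iff_funcset Ball_def imp_conjL)
qed

section \<open>The local compactness functional and compactness\<close>

text \<open>
  The value \<open>0\<close> at points without a compact neighbourhood fits in: there no closure of a ball is
  compact, because such a closure would be a compact neighbourhood.
\<close>
lemma noncompact_closure_if_local_compactness_less:
  assumes "x \<in> mspace X" "r > 0" "local_compactness X x < ereal r"
  shows "\<not> compactin (mtopology_of X) (mtopology_of X closure_of mball_of X x r)"
proof
  let ?T = "mtopology_of X"
  interpret Metric_space "mspace X" "mdist X" by simp
  assume c: "compactin ?T (?T closure_of mball_of X x r)"
  have "openin ?T (mball_of X x r)" 
    by (simp add: mball_of_def mtopology_of_def)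
  then have "\<exists>U K. openin ?T U \<and> x \<in> U \<and> U \<subseteq> K \<and> compactin ?T K"
    using assms c closure_of_subset[OF openin_subset] 
    by (metis centre_in_mball_iff mball_of_def)
  then have "local_compactness X x \<ge> ereal r"
    unfolding local_compactness_def using assms c by (auto intro!: Sup_upper)
  with assms show False by simp
qed

text \<open>
  Compactness of closures passes from a ball to the smaller concentric balls, so no radius in the
  defining supremum exceeds \<open>r\<close>.
\<close>
lemma local_compactness_le_if_noncompact_closure:
  assumes "r > 0" "\<not> compactin (mtopology_of X) (mtopology_of X closure_of mball_of X x r)"
  shows "local_compactness X x \<le> ereal r"
proof -
  let ?T = "mtopology_of X"
  have "\<epsilon> \<le> r" if "compactin ?T (?T closure_of mball_of X x \<epsilon>)" for \<epsilon>
  proof (rule ccontr)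
    assume "\<not> \<epsilon> \<le> r"
    then have "?T closure_of mball_of X x r \<subseteq> ?T closure_of mball_of X x \<epsilon>"
      by (intro closure_of_mono) auto
    then show False
      using closed_compactin[OF that] assms(2) by simp
  qed
  then show ?thesis
    using assms(1) unfolding local_compactness_def by (auto intro!: Sup_least)
qed

lemma cluster_point_in_compact:
  fixes x :: "nat \<Rightarrow> 'a"
  assumes "compactin (mtopology_of X) K" "range x \<subseteq> K"
  shows "\<exists>p. cluster_point_of_seq (mtopology_of X) x p"
proof -
  interpret Metric_space "mspace X" "mdist X" by simp
  obtain p s where "p \<in> K" "strict_mono (s :: nat \<Rightarrow> nat)" and lim: "limitin mtopology (x \<circ> s) p sequentially"
    using assms unfolding mtopology_of_def compactin_sequentially by blast
  have "infinite {n. x n \<in> mball_of X p r}" if "r > 0" for r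
  proof -
    obtain N where N: "\<And>n. n \<ge> N \<Longrightarrow> x (s n) \<in> mball p r"
      using limitinD[OF lim openin_mball, of p r] limitin_mspace[OF lim] \<open>r > 0\<close>
      by (auto simp: eventually_sequentially)
    have "infinite (s ` {N..})"
      using \<open>strict_mono s\<close> by (simp add: finite_image_iff strict_mono_imp_inj_on inj_on_subset infinite_Ici)
    moreover have "s ` {N..} \<subseteq> {n. x n \<in> mball_of X p r}" 
      using N by (auto simp: mball_of_def)
    ultimately show ?thesis using infinite_super by blast
  qed
  moreover have "p \<in> mspace X" using lim limitin_mspace by blast
  ultimately show ?thesis by (auto simp: cluster_point_of_seq_iff_infinite)
qed

text \<open>
  By the Bolzano-Weierstrass characterization of compactness there is an infinite subset without a
  limit point in the set, and, the set being closed, without any limit point at all. An injective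
  enumeration of part of that subset does not cluster: near a cluster point its infinitely many indices
  would give infinitely many points.
\<close>
lemma noncompact_closed_has_discrete_sequence:
  assumes "closedin (mtopology_of X) S" "\<not> compactin (mtopology_of X) S"
  obtains w :: "nat \<Rightarrow> 'a" where "range w \<subseteq> S" "\<not> (\<exists>p. cluster_point_of_seq (mtopology_of X) w p)"
proof -
  interpret Metric_space "mspace X" "mdist X" by simp
  have "S \<subseteq> mspace X" using closedin_subset[OF assms(1)] by simp
  then obtain T where T: "T \<subseteq> S" "infinite T" "S \<inter> mtopology_of X derived_set_of T = {}"
    using assms unfolding mtopology_of_def compactin_eq_Bolzano_Weierstrass by blast
  have dT: "mtopology_of X derived_set_of T = {}"
    using T(3) derived_set_of_mono[OF \<open>T \<subseteq> S\<close>, of "mtopology_of X"]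
      assms(1)[unfolded closedin_contains_derived_set] by blast
  obtain w :: "nat \<Rightarrow> 'a" where w: "inj w" "range w \<subseteq> T"
    using infinite_countable_subset[OF \<open>infinite T\<close>] by blast
  have "\<not> cluster_point_of_seq (mtopology_of X) w p" for p
  proof
    assume "cluster_point_of_seq (mtopology_of X) w p"
    then have p: "p \<in> mspace X" "\<And>r. r > 0 \<Longrightarrow> infinite {n. w n \<in> mball_of X p r}"
      by (auto simp: cluster_point_of_seq_iff_infinite)
    have "infinite (T \<inter> mball_of X p r)" if "r > 0" for r
    proof -
      have "infinite (w ` {n. w n \<in> mball_of X p r})"
        using p(2)[OF that] inj_on_subset[OF w(1)] by (simp add: finite_image_iff)
      moreover have "w ` {n. w n \<in> mball_of X p r} \<subseteq> T \<inter> mball_of X p r" using w(2) by auto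
      ultimately show ?thesis using infinite_super by blast
    qed
    with p(1) have "p \<in> mtopology_of X derived_set_of T" 
      by (simp add: derived_set_of_mtopology_of)
    with dT show False by simp
  qed
  with that[of w] w(2) \<open>T \<subseteq> S\<close> show thesis by blast
qed

lemma in_closure_of_mball_of:
  assumes "y \<in> mtopology_of X closure_of mball_of X x r"
  shows "x \<in> mspace X" "y \<in> mspace X" "mdist X x y \<le> r"
proof -
  interpret Metric_space "mspace X" "mdist X" by simp
  have "y \<in> mcball x r"
    using assms closure_of_minimal[OF mball_subset_mcball closedin_mcball]
    unfolding mtopology_of_def mball_of_def by blast
  then show "x \<in> mspace X" "y \<in> mspace X" "mdist X x y \<le> r" by auto
qed

section \<open>Cofinal completeness gives strong uniform continuity\<close>

text \<open>
  This is the only use of cofinal completeness: it is applied to an enumeration of countably many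
  rows, the \<open>n\<close>-th of which has no cluster point and stays within \<open>1 / Suc n\<close> of \<open>x n\<close>.
\<close>
lemma cluster_point_if_local_compactness_vanishes:
  fixes x :: "nat \<Rightarrow> 'a"
  assumes cc: "cofinally_complete X" and x: "range x \<subseteq> mspace X"
    and nu: "\<And>n. local_compactness X (x n) < ereal (1 / Suc n)"
  shows "\<exists>p. cluster_point_of_seq (mtopology_of X) x p"
proof -
  let ?T = "mtopology_of X"
  have "\<exists>w :: nat \<Rightarrow> 'a. range w \<subseteq> ?T closure_of mball_of X (x n) (1 / Suc n) \<and>
          \<not> (\<exists>p. cluster_point_of_seq ?T w p)" for n
    using noncompact_closed_has_discrete_sequence[OF closedin_closure_of]
      noncompact_closure_if_local_compactness_less[OF _ _ nu[of n]] x
    by (metis divide_pos_pos of_nat_0_less_iff range_subsetD zero_less_Suc zero_less_one)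
  then obtain w :: "nat \<Rightarrow> nat \<Rightarrow> 'a"
    where w: "\<And>n. range (w n) \<subseteq> ?T closure_of mball_of X (x n) (1 / Suc n)"
      and nocl: "\<And>n p. \<not> cluster_point_of_seq ?T (w n) p" by metis
  have wM: "w n k \<in> mspace X" and wd: "mdist X (x n) (w n k) \<le> 1 / Suc n" for n k
    using in_closure_of_mball_of w by (meson range_subsetD)+
  define \<sigma> where "\<sigma> m = (case prod_decode m of (n, k) \<Rightarrow> w n k)" for m
  have \<sigma>_enc [simp]: "\<sigma> (prod_encode (n, k)) = w n k" for n k by (simp add: \<sigma>_def)
  interpret Metric_space "mspace X" "mdist X" by simp
  have "cofinally_Cauchy X \<sigma>"
    unfolding cofinally_Cauchy_def
  proof (intro conjI allI impI)
    show "range \<sigma> \<subseteq> mspace X" using wM by (auto simp: \<sigma>_def split: prod.splits)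
    fix \<epsilon> :: real assume "\<epsilon> > 0"
    then obtain n where n: "1 / Suc n < \<epsilon> / 2"
      using nat_approx_posE[of "\<epsilon> / 2"] by auto
    \<comment> \<open>A single row far enough down is an infinite set of indices with small diameter.\<close>
    show "\<exists>N. infinite N \<and> (\<forall>i\<in>N. \<forall>j\<in>N. mdist X (\<sigma> i) (\<sigma> j) < \<epsilon>)"
    proof (intro exI[of _ "range (\<lambda>k. prod_encode (n, k))"] conjI ballI)
      show "infinite (range (\<lambda>k. prod_encode (n, k)))"
        by (intro range_inj_infinite injI) simp
      fix i j assume "i \<in> range (\<lambda>k. prod_encode (n, k))" "j \<in> range (\<lambda>k. prod_encode (n, k))"
      then obtain k l where "\<sigma> i = w n k" "\<sigma> j = w n l" by auto
      then show "mdist X (\<sigma> i) (\<sigma> j) < \<epsilon>"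
        using triangle'[of "w n k" "x n" "w n l"] wM wd[of n k] wd[of n l] n x commute
        by (smt (verit) field_sum_of_halves range_subsetD)
    qed
  qed
  then obtain p where p: "p \<in> mspace X" "\<And>r. r > 0 \<Longrightarrow> infinite {m. \<sigma> m \<in> mball_of X p r}"
    using cc by (auto simp: cofinally_complete_def cluster_point_of_seq_iff_infinite)
  have "infinite {n. x n \<in> mball_of X p r}" if "r > 0" for r
  proof
    assume fin: "finite {n. x n \<in> mball_of X p r}"
    obtain N where N: "1 / Suc N < r / 2"
      using nat_approx_posE[of "r / 2"] \<open>r > 0\<close> by auto
    \<comment> \<open>The rows outside \<open>F\<close> have their centre at distance at least \<open>r\<close> from \<open>p\<close> and their points
        closer than \<open>r / 2\<close> to the centre, so they avoid a ball of radius \<open>r / 2\<close> around \<open>p\<close>. Each of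
        the finitely many rows in \<open>F\<close> meets some ball around \<open>p\<close> only finitely often. Hence so does
        the whole enumeration.\<close>
    define F where "F = {n. x n \<in> mball_of X p r} \<union> {..<N}"
    have "finite F" using fin by (simp add: F_def)
    have "\<exists>s>0. finite {k. w n k \<in> mball_of X p s}" for n
      using nocl[of n p] p(1) by (auto simp: cluster_point_of_seq_iff_infinite)
    then obtain s where s: "\<And>n. s n > 0" "\<And>n. finite {k. w n k \<in> mball_of X p (s n)}" by metis
    define t where "t = Min (insert (r / 2) (s ` F))"
    have "t > 0" using s(1) \<open>r > 0\<close> \<open>finite F\<close> by (simp add: t_def)
    have t: "t \<le> r / 2" "\<And>n. n \<in> F \<Longrightarrow> t \<le> s n"
      unfolding t_def using \<open>finite F\<close> by (intro Min_le; simp)+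
    have inF: "n \<in> F" if "w n k \<in> mball_of X p t" for n k
    proof (rule ccontr)
      assume "n \<notin> F"
      then have "n \<ge> N" and far: "x n \<notin> mball_of X p r" by (auto simp: F_def)
      have "1 / Suc n \<le> 1 / Suc N" using \<open>n \<ge> N\<close> by (simp add: field_simps)
      moreover have xn: "x n \<in> mspace X" using x by auto
      moreover have "mdist X p (w n k) < t" using that by simp
      ultimately have "mdist X p (x n) < r"
        using triangle[OF p(1) wM xn, of n k] wd[of n k] N t(1) commute[of "x n" "w n k"]
        by linarith
      with far p(1) xn show False by simp
    qed
    have "{m. \<sigma> m \<in> mball_of X p t} \<subseteq>
            (\<Union>n\<in>F. (\<lambda>k. prod_encode (n, k)) ` {k. w n k \<in> mball_of X p (s n)})"
    proof
      fix m assume m: "m \<in> {m. \<sigma> m \<in> mball_of X p t}"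
      obtain n k where nk: "m = prod_encode (n, k)" by (metis prod_decode_inverse surj_pair)
      with m have wk: "w n k \<in> mball_of X p t" by simp
      have "n \<in> F" using inF[OF wk] .
      moreover have "w n k \<in> mball_of X p (s n)" using wk t(2)[OF \<open>n \<in> F\<close>] by auto
      ultimately show "m \<in> (\<Union>n\<in>F. (\<lambda>k. prod_encode (n, k)) ` {k. w n k \<in> mball_of X p (s n)})"
        using nk by blast
    qed
    then have "finite {m. \<sigma> m \<in> mball_of X p t}"
      by (rule finite_subset) (use \<open>finite F\<close> s(2) in blast)
    with p(2)[OF \<open>t > 0\<close>] show False by simp
  qed
  with p(1) show ?thesis by (auto simp: cluster_point_of_seq_iff_infinite)
qed

text \<open>
  A sequence \<open>x\<close> in \<open>A\<close> with bad partners \<open>y\<close> closer and closer to it cannot cluster, by continuity.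
  Such sequences with \<open>x\<close> clustering exist, for one of two reasons: either bad pairs at every scale
  can be found in one of the compact sets from the definition of \<open>AC X\<close>, or the local compactness
  functional is small on all sufficiently tight bad pairs. The dichotomy speaks of pairs and
  scales rather than of one given sequence, so each case supplies a sequence with the exact bounds
  \<open>1 / Suc n\<close>.
\<close>
lemma cofinally_complete_imp_strongly_uniform:
  fixes X :: "'a metric" and Y :: "'b metric"
  assumes cc: "cofinally_complete X"
  shows "continuous_strongly_uniform_on_AC X Y"
  unfolding continuous_strongly_uniform_on_AC_def strongly_uniformly_continuous_on_def
proof (intro allI impI ballI, rule ccontr)
  fix f :: "'a \<Rightarrow> 'b" and A :: "'a set" and \<epsilon> :: real
  assume cont: "continuous_map (mtopology_of X) (mtopology_of Y) f"
    and A: "A \<in> AC X" and "\<epsilon> > 0"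
    and neg: "\<not> (\<exists>\<delta>>0. \<forall>x\<in>mspace X. \<forall>y\<in>mspace X.
                  mdist X x y < \<delta> \<and> {x, y} \<inter> A \<noteq> {} \<longrightarrow> mdist Y (f x) (f y) < \<epsilon>)"
  interpret X: Metric_space "mspace X" "mdist X" by simp
  interpret Y: Metric_space "mspace Y" "mdist Y" by simp
  define bad where "bad \<delta> x y \<longleftrightarrow> x \<in> A \<and> x \<in> mspace X \<and> y \<in> mspace X \<and> mdist X x y < \<delta> \<and>
      \<not> mdist Y (f x) (f y) < \<epsilon>" for \<delta> x y
  \<comment> \<open>Both metrics are symmetric, so the point lying in \<open>A\<close> may be taken to be the first one.\<close>
  have ex_bad: "\<exists>x y. bad \<delta> x y" if "\<delta> > 0" for \<delta>
    using neg that unfolding bad_def by (metis X.commute Y.commute disjoint_insert(2) inf_bot_left insert_disjoint(1))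
  have bad_mono: "bad \<delta>' x y" if "bad \<delta> x y" "\<delta> \<le> \<delta>'" for \<delta> \<delta>' x y
    using that unfolding bad_def by linarith
  have fM: "f z \<in> mspace Y" if "z \<in> mspace X" for z
    using cont that by (auto simp: continuous_map_mtopology_of_iff)
  have no_cluster: False
    if bad: "\<And>n. bad (1 / Suc n) (x n) (y n)" and p: "cluster_point_of_seq (mtopology_of X) x p"
    for x y :: "nat \<Rightarrow> 'a" and p
  proof -
    have pM: "p \<in> mspace X" using p by (simp add: cluster_point_of_seq_iff_infinite)
    then obtain \<delta> where "\<delta> > 0"
      and \<delta>: "\<And>z. z \<in> mspace X \<Longrightarrow> mdist X p z < \<delta> \<Longrightarrow> mdist Y (f p) (f z) < \<epsilon> / 2"
      using cont \<open>\<epsilon> > 0\<close> half_gt_zero unfolding continuous_map_mtopology_of_iff by metis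
    obtain N where N: "1 / Suc N < \<delta> / 2"
      using nat_approx_posE[of "\<delta> / 2"] \<open>\<delta> > 0\<close> by auto
    have "infinite {n. x n \<in> mball_of X p (\<delta> / 2)}"
      using p half_gt_zero[OF \<open>\<delta> > 0\<close>] unfolding cluster_point_of_seq_iff_infinite by blast
    then obtain n where "n \<ge> N" and xn: "x n \<in> mball_of X p (\<delta> / 2)"
      unfolding infinite_nat_iff_unbounded_le by blast
    have "1 / Suc n \<le> 1 / Suc N" using \<open>n \<ge> N\<close> by (simp add: field_simps)
    then have d: "mdist X (x n) (y n) < \<delta> / 2" and M: "x n \<in> mspace X" "y n \<in> mspace X"
      and big: "\<not> mdist Y (f (x n)) (f (y n)) < \<epsilon>"
      using bad[of n] N unfolding bad_def by auto
    have "mdist X p (x n) < \<delta>" "mdist X p (y n) < \<delta>"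
      using xn d \<open>\<delta> > 0\<close> X.triangle[OF pM M] by auto
    then have "mdist Y (f p) (f (x n)) < \<epsilon> / 2" "mdist Y (f p) (f (y n)) < \<epsilon> / 2"
      using \<delta> M by auto
    then show False
      using big Y.triangle'[of "f (x n)" "f p" "f (y n)"] fM M pM by (simp add: Y.commute)
  qed
  show False
  proof (cases "\<exists>e>0. \<forall>\<delta>>0. \<exists>x y. bad \<delta> x y \<and> local_compactness X x \<ge> ereal e")
    case True
    then obtain e where "e > 0" and e: "\<And>\<delta>. \<delta> > 0 \<Longrightarrow> \<exists>x y. bad \<delta> x y \<and> local_compactness X x \<ge> ereal e"
      by blast
    have "\<exists>x y. bad (1 / Suc n) x y \<and> local_compactness X x \<ge> ereal e" for n
      using e[of "1 / Suc n"] by simp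
    then obtain x y where xy: "\<And>n. bad (1 / Suc n) (x n) (y n)" "\<And>n. local_compactness X (x n) \<ge> ereal e"
      by metis
    have "compactin (mtopology_of X) {a \<in> A. local_compactness X a \<ge> ereal e}"
      using A \<open>e > 0\<close> by (simp add: AC_def)
    moreover have "range x \<subseteq> {a \<in> A. local_compactness X a \<ge> ereal e}"
      using xy unfolding bad_def by auto
    ultimately show False
      using cluster_point_in_compact no_cluster xy(1) by metis
  next
    case False
    then have "\<exists>\<delta>>0. \<forall>x y. bad \<delta> x y \<longrightarrow> local_compactness X x < ereal (1 / Suc n)" for n
      by (metis linorder_not_le divide_pos_pos of_nat_0_less_iff zero_less_Suc zero_less_one)
    then obtain \<delta> where \<delta>: "\<And>n. \<delta> n > 0"
        "\<And>n x y. bad (\<delta> n) x y \<Longrightarrow> local_compactness X x < ereal (1 / Suc n)" by metis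
    have "\<exists>x y. bad (min (1 / Suc n) (\<delta> n)) x y" for n
      using ex_bad[of "min (1 / Suc n) (\<delta> n)"] \<delta>(1)[of n] by simp
    then obtain x y where xy: "\<And>n. bad (min (1 / Suc n) (\<delta> n)) (x n) (y n)" by metis
    have "\<And>n. bad (1 / Suc n) (x n) (y n)" "\<And>n. local_compactness X (x n) < ereal (1 / Suc n)"
      by (rule bad_mono[OF xy], simp) (rule \<delta>(2)[OF bad_mono[OF xy]], simp)
    moreover have "range x \<subseteq> mspace X" using xy unfolding bad_def by auto
    ultimately show False
      using cluster_point_if_local_compactness_vanishes[OF cc] no_cluster by metis
  qed
qed

section \<open>Strong uniform continuity preserves nearness\<close>

lemma nonneg_eq_0_iff_less_all_pos:
  fixes v :: real
  assumes "v \<ge> 0"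
  shows "v = 0 \<longleftrightarrow> (\<forall>\<epsilon>>0. v < \<epsilon>)"
proof
  assume *: "\<forall>\<epsilon>>0. v < \<epsilon>"
  have "\<not> 0 < v" using *[rule_format, of v] by blast
  with assms show "v = 0" by simp
qed simp

lemma mgap_eq_0_iff:
  assumes "A \<noteq> {}" "B \<noteq> {}"
  shows "mgap X A B = 0 \<longleftrightarrow> (\<forall>\<epsilon>>0. \<exists>a\<in>A. \<exists>b\<in>B. mdist X a b < \<epsilon>)"
proof -
  let ?D = "{mdist X a b | a b. a \<in> A \<and> b \<in> B}"
  have ne: "?D \<noteq> {}" using assms by auto
  have bdd: "bdd_below ?D" by (rule bdd_belowI[of _ 0]) auto
  have "Inf ?D \<ge> 0" using ne by (intro cInf_greatest) auto
  then have "Inf ?D = 0 \<longleftrightarrow> (\<forall>\<epsilon>>0. Inf ?D < \<epsilon>)"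
    by (rule nonneg_eq_0_iff_less_all_pos)
  also have "\<dots> \<longleftrightarrow> (\<forall>\<epsilon>>0. \<exists>a\<in>A. \<exists>b\<in>B. mdist X a b < \<epsilon>)"
    unfolding cInf_less_iff[OF ne bdd] by (intro all_cong) blast
  finally show ?thesis unfolding mgap_def .
qed

lemma AC_subset_mspace: "A \<in> AC X \<Longrightarrow> A \<subseteq> mspace X"
  by (auto simp: AC_def dest!: closedin_subset)

lemma strongly_uniform_imp_preserves_nearness:
  assumes "continuous_strongly_uniform_on_AC X Y"
  shows "continuous_preserves_nearness_to_AC X Y"
  unfolding continuous_preserves_nearness_to_AC_def
proof (intro allI impI ballI)
  fix f A B
  assume f: "continuous_map (mtopology_of X) (mtopology_of Y) f" and A: "A \<in> AC X"
    and B: "B \<noteq> {} \<and> B \<subseteq> mspace X" and gap: "mgap X A B = 0"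
  have ne: "A \<noteq> {}" and AM: "A \<subseteq> mspace X" using A AC_subset_mspace by (auto simp: AC_def)
  have "\<exists>a\<in>A. \<exists>b\<in>B. mdist Y (f a) (f b) < \<epsilon>" if "\<epsilon> > 0" for \<epsilon>
  proof -
    obtain \<delta> where "\<delta> > 0" and \<delta>: "\<And>x y. \<lbrakk>x \<in> mspace X; y \<in> mspace X; mdist X x y < \<delta>; {x, y} \<inter> A \<noteq> {}\<rbrakk>
        \<Longrightarrow> mdist Y (f x) (f y) < \<epsilon>"
      using assms f A \<open>\<epsilon> > 0\<close>
      unfolding continuous_strongly_uniform_on_AC_def strongly_uniformly_continuous_on_def by metis
    obtain a b where "a \<in> A" "b \<in> B" "mdist X a b < \<delta>"
      using gap \<open>\<delta> > 0\<close> B unfolding mgap_eq_0_iff[OF ne conjunct1[OF B]] by blast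
    with \<delta>[of a b] AM B show ?thesis by auto
  qed
  then show "mgap Y (f ` A) (f ` B) = 0"
    using ne B by (subst mgap_eq_0_iff) auto
qed

section \<open>Nearness characterizes cofinal completeness\<close>

text \<open>
  Well-founded choice: each element is taken outside the finitely many that were chosen before.
\<close>
lemma injective_choice_from_infinite_sets:
  fixes C :: "nat \<Rightarrow> 'a set"
  assumes "\<And>n. infinite (C n)"
  obtains c where "inj c" "\<And>n. c n \<in> C n"
proof -
  have "\<exists>c. \<forall>n. c n \<in> C n \<and> c n \<notin> c ` {..<n}"
  proof (rule dependent_wf_choice[OF wf_less])
    fix f g :: "nat \<Rightarrow> 'a" and n x
    assume "\<And>z. (z, n) \<in> {(x, y). x < y} \<Longrightarrow> f z = g z"
    then have "f ` {..<n} = g ` {..<n}" by (intro image_cong) auto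
    then show "(x \<in> C n \<and> x \<notin> f ` {..<n}) = (x \<in> C n \<and> x \<notin> g ` {..<n})" by simp
  next
    fix n and f :: "nat \<Rightarrow> 'a"
    show "\<exists>x. x \<in> C n \<and> x \<notin> f ` {..<n}"
      using assms[of n] by (meson finite_imageI finite_lessThan finite_subset subsetI)
  qed
  then obtain c where c: "\<And>n. c n \<in> C n" "\<And>n. c n \<notin> c ` {..<n}" by blast
  have "inj c"
  proof (rule linorder_injI)
    fix m n :: nat assume "m < n"
    then show "c m \<noteq> c n" using c(2)[of n] by (metis imageI lessThan_iff)
  qed
  with c(1) that show thesis by blast
qed

text \<open>
  The metric \<open>d(x, y) + \<bar>f x - f y\<bar>\<close> for an Urysohn function \<open>f\<close> of \<open>A\<close> and \<open>B\<close>, carried over to the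
  image of \<open>\<iota>\<close>. Adding \<open>d\<close> makes it separate points, and continuity of \<open>f\<close> makes \<open>\<iota>\<close> continuous.
\<close>
lemma separating_remetrization:
  fixes X :: "'a metric" and \<iota> :: "'a \<Rightarrow> 'b"
  assumes \<iota>: "inj_on \<iota> (mspace X)"
    and A: "closedin (mtopology_of X) A" and B: "closedin (mtopology_of X) B" and dis: "A \<inter> B = {}"
  obtains Y :: "'b metric" where "continuous_map (mtopology_of X) (mtopology_of Y) \<iota>"
    "\<And>a b. a \<in> A \<Longrightarrow> b \<in> B \<Longrightarrow> mdist Y (\<iota> a) (\<iota> b) \<ge> 1"
proof -
  interpret X: Metric_space "mspace X" "mdist X" by simp
  have "normal_space (mtopology_of X)"
    by (simp add: mtopology_of_def X.normal_space_mtopology)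
  then obtain f where f: "continuous_map (mtopology_of X) (top_of_set {0..1::real}) f"
    and fA: "f ` A \<subseteq> {0}" and fB: "f ` B \<subseteq> {1}"
    using Urysohn_lemma[OF _ A B, of 0 1] dis by (auto simp: disjnt_def)
  have AM: "A \<subseteq> mspace X" "B \<subseteq> mspace X" using closedin_subset A B by fastforce+
  define g where "g = the_inv_into (mspace X) \<iota>"
  have g: "g (\<iota> x) = x" if "x \<in> mspace X" for x
    using that \<iota> by (simp add: g_def the_inv_into_f_f)
  define \<rho> where "\<rho> u v = mdist X (g u) (g v) + \<bar>f (g u) - f (g v)\<bar>" for u v
  interpret Y: Metric_space "\<iota> ` mspace X" \<rho>
  proof
    show "0 \<le> \<rho> u v" for u v by (simp add: \<rho>_def)
    show "\<rho> u v = \<rho> v u" for u v by (simp add: \<rho>_def X.commute abs_minus_commute)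
    show "\<rho> u v = 0 \<longleftrightarrow> u = v" if "u \<in> \<iota> ` mspace X" "v \<in> \<iota> ` mspace X" for u v
    proof -
      obtain x y where "x \<in> mspace X" "y \<in> mspace X" "u = \<iota> x" "v = \<iota> y" using \<open>u \<in> _\<close> \<open>v \<in> _\<close> by blast
      then show ?thesis using \<iota> by (auto simp: \<rho>_def g add_nonneg_eq_0_iff dest: inj_onD)
    qed
    show "\<rho> u w \<le> \<rho> u v + \<rho> v w" if "u \<in> \<iota> ` mspace X" "v \<in> \<iota> ` mspace X" "w \<in> \<iota> ` mspace X" for u v w
    proof -
      have "g u \<in> mspace X" "g v \<in> mspace X" "g w \<in> mspace X" using that g by auto
      from X.triangle[OF this] show ?thesis by (simp add: \<rho>_def)
    qed
  qed
  let ?Y = "metric (\<iota> ` mspace X, \<rho>)"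
  have fcont: "continuous_map (mtopology_of X) (mtopology_of euclidean_metric) f"
    using f continuous_map_in_subtopology by auto
  have "continuous_map (mtopology_of X) (mtopology_of ?Y) \<iota>"
    unfolding continuous_map_mtopology_of_iff
  proof (intro conjI ballI allI impI)
    show "\<iota> \<in> mspace X \<rightarrow> mspace ?Y" by simp
    fix a and \<epsilon> :: real assume a: "a \<in> mspace X" and "\<epsilon> > 0"
    then obtain \<delta> where "\<delta> > 0"
      and \<delta>: "\<And>x. x \<in> mspace X \<Longrightarrow> mdist X a x < \<delta> \<Longrightarrow> dist (f a) (f x) < \<epsilon> / 2"
      using fcont half_gt_zero[OF \<open>\<epsilon> > 0\<close>] unfolding continuous_map_mtopology_of_iff mdist_euclidean_metric by metis
    show "\<exists>\<delta>>0. \<forall>x\<in>mspace X. mdist X a x < \<delta> \<longrightarrow> mdist ?Y (\<iota> a) (\<iota> x) < \<epsilon>"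
    proof (intro exI[of _ "min \<delta> (\<epsilon> / 2)"] conjI ballI impI)
      show "0 < min \<delta> (\<epsilon> / 2)" using \<open>\<delta> > 0\<close> \<open>\<epsilon> > 0\<close> by simp
      fix x assume x: "x \<in> mspace X" "mdist X a x < min \<delta> (\<epsilon> / 2)"
      then show "mdist ?Y (\<iota> a) (\<iota> x) < \<epsilon>"
        using \<delta>[of x] a by (simp add: \<rho>_def g dist_real_def)
    qed
  qed
  moreover have "mdist ?Y (\<iota> a) (\<iota> b) \<ge> 1" if "a \<in> A" "b \<in> B" for a b
  proof -
    have "f a = 0" "f b = 1" "a \<in> mspace X" "b \<in> mspace X" using that fA fB AM by auto
    then show ?thesis by (simp add: \<rho>_def g)
  qed
  ultimately show thesis using that by blast
qed

text \<open>
  Take a cofinally Cauchy sequence without cluster points. Near every point it has only finitely many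
  indices, so every subset of its range is closed and discrete, and every infinite set of indices
  carries infinitely many points. A ball that contains infinitely many of these points therefore has a
  noncompact closure, which bounds the local compactness functional at its centre.
\<close>
lemma AC_witness_if_not_cofinally_complete:
  fixes X :: "'a metric"
  assumes "\<not> cofinally_complete X"
  obtains A B where "A \<in> AC X" "B \<noteq> {}" "closedin (mtopology_of X) B" "A \<inter> B = {}" "mgap X A B = 0"
proof -
  let ?T = "mtopology_of X"
  interpret Metric_space "mspace X" "mdist X" by simp
  obtain \<sigma> where \<sigma>: "cofinally_Cauchy X \<sigma>" and nocl: "\<And>p. \<not> cluster_point_of_seq ?T \<sigma> p"
    using assms by (auto simp: cofinally_complete_def)
  have \<sigma>M: "range \<sigma> \<subseteq> mspace X" using \<sigma> by (simp add: cofinally_Cauchy_def)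
  have \<sigma>mem: "\<sigma> i \<in> mspace X" for i using \<sigma>M by auto
  have fin: "\<exists>r>0. finite {n. \<sigma> n \<in> mball_of X p r}" if "p \<in> mspace X" for p
    using nocl[of p] that by (auto simp: cluster_point_of_seq_iff_infinite)
  have no_derived: "?T derived_set_of S = {}" if "S \<subseteq> range \<sigma>" for S
  proof -
    have "\<exists>r>0. finite (S \<inter> mball_of X p r)" if p: "p \<in> mspace X" for p
    proof -
      obtain r where r: "r > 0" "finite {n. \<sigma> n \<in> mball_of X p r}" using fin[OF p] by blast
      have "S \<inter> mball_of X p r \<subseteq> \<sigma> ` {n. \<sigma> n \<in> mball_of X p r}" using \<open>S \<subseteq> range \<sigma>\<close> by blast
      with r show ?thesis by (meson finite_imageI finite_subset)
    qed
    then show ?thesis unfolding derived_set_of_mtopology_of by auto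
  qed
  have closed: "closedin ?T S" if "S \<subseteq> range \<sigma>" for S
    using no_derived[OF that] that \<sigma>M by (auto simp: closedin_contains_derived_set)
  have "\<exists>N. infinite N \<and> (\<forall>i\<in>N. \<forall>j\<in>N. mdist X (\<sigma> i) (\<sigma> j) < 1 / Suc n)" for n
    using \<sigma> unfolding cofinally_Cauchy_def by (meson divide_pos_pos of_nat_0_less_iff zero_less_Suc zero_less_one)
  then obtain N where N: "\<And>n. infinite (N n)"
    and diam: "\<And>n i j. i \<in> N n \<Longrightarrow> j \<in> N n \<Longrightarrow> mdist X (\<sigma> i) (\<sigma> j) < 1 / Suc n" by metis
  define C where "C n = \<sigma> ` N n" for n
  have infC: "infinite (C n)" for n
  proof
    assume "finite (C n)"
    then obtain i where i: "i \<in> N n" "infinite {j \<in> N n. \<sigma> j = \<sigma> i}"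
      using pigeonhole_infinite[OF N[of n], of \<sigma>] by (auto simp: C_def)
    have "\<sigma> i \<in> mspace X" using \<sigma>M by auto
    then obtain r where "r > 0" "finite {n. \<sigma> n \<in> mball_of X (\<sigma> i) r}" using fin by blast
    moreover have "{j \<in> N n. \<sigma> j = \<sigma> i} \<subseteq> {n. \<sigma> n \<in> mball_of X (\<sigma> i) r}"
      using \<open>r > 0\<close> \<open>\<sigma> i \<in> mspace X\<close> by auto
    ultimately show False using i(2) finite_subset by blast
  qed
  have Csub: "C n \<subseteq> range \<sigma>" for n by (auto simp: C_def)
  have nu: "local_compactness X a \<le> ereal (1 / Suc n)" if "a \<in> C n" for a n
  proof (rule local_compactness_le_if_noncompact_closure)
    let ?S = "?T closure_of mball_of X a (1 / Suc n)"
    have "mball_of X a (1 / Suc n) \<subseteq> ?S"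
      by (rule closure_of_subset) auto
    moreover have "C n \<subseteq> mball_of X a (1 / Suc n)" using that diam \<sigma>mem by (auto simp: C_def)
    ultimately have "C n \<subseteq> ?S" by blast
    then show "\<not> compactin ?T ?S"
      using compactin_imp_Bolzano_Weierstrass[of ?T ?S "C n"] infC no_derived[OF Csub] by blast
  qed simp
  \<comment> \<open>Two points from each \<open>C n\<close>: the even-indexed choices make up \<open>A\<close>, the odd-indexed ones \<open>B\<close>.\<close>
  obtain c where c: "inj c" "\<And>m. c m \<in> C (m div 2)"
    using injective_choice_from_infinite_sets[of "\<lambda>m. C (m div 2)"] infC by blast
  define a where "a n = c (2 * n)" for n
  define b where "b n = c (Suc (2 * n))" for n
  have ab: "a n \<in> C n" "b n \<in> C n" for n
    using c(2)[of "2 * n"] c(2)[of "Suc (2 * n)"] by (auto simp: a_def b_def)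
  have sub: "range a \<subseteq> range \<sigma>" "range b \<subseteq> range \<sigma>" using ab Csub by blast+
  have "range a \<inter> range b = {}"
  proof -
    have "a n \<noteq> b m" for n m
      using c(1) by (metis a_def b_def double_not_eq_Suc_double injD)
    then show ?thesis by auto
  qed
  moreover have "mgap X (range a) (range b) = 0"
  proof (subst mgap_eq_0_iff; (intro allI impI)?)
    fix \<epsilon> :: real assume "\<epsilon> > 0"
    then obtain n where "1 / Suc n < \<epsilon>" using nat_approx_posE by metis
    moreover have "mdist X (a n) (b n) < 1 / Suc n" using ab[of n] diam by (auto simp: C_def)
    ultimately show "\<exists>x\<in>range a. \<exists>y\<in>range b. mdist X x y < \<epsilon>" by (meson order_less_trans rangeI)
  qed auto
  moreover have "range a \<in> AC X"
  proof -
    \<comment> \<open>Only finitely many \<open>n\<close> satisfy \<open>\<epsilon> \<le> 1 / Suc n\<close>, so this set is even finite.\<close>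
    have "compactin ?T {x \<in> range a. local_compactness X x \<ge> ereal \<epsilon>}" if \<epsilon>: "\<epsilon> > 0" for \<epsilon>
    proof (rule finite_imp_compactin)
      obtain n where n: "1 / Suc n < \<epsilon>" using nat_approx_posE[OF \<epsilon>] by metis
      have "k < n" if "local_compactness X (a k) \<ge> ereal \<epsilon>" for k
      proof (rule ccontr)
        assume "\<not> k < n"
        then have "1 / Suc k \<le> 1 / Suc n" by (simp add: field_simps)
        with n have "1 / Suc k < \<epsilon>" by linarith
        moreover have "ereal \<epsilon> \<le> ereal (1 / Suc k)" using that nu[OF ab(1)[of k]] by (rule order_trans)
        ultimately show False by simp
      qed
      then have "{x \<in> range a. local_compactness X x \<ge> ereal \<epsilon>} \<subseteq> a ` {..<n}" by auto
      then show "finite {x \<in> range a. local_compactness X x \<ge> ereal \<epsilon>}"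
        using finite_subset by blast
      show "{x \<in> range a. local_compactness X x \<ge> ereal \<epsilon>} \<subseteq> topspace ?T" using sub \<sigma>M by auto
    qed
    then show ?thesis using closed[OF sub(1)] by (simp add: AC_def)
  qed
  ultimately show thesis by (intro that[of "range a" "range b"] closed[OF sub(2)]) auto
qed

text \<open>
  In the metric space provided by \<open>separating_remetrization\<close> the witnesses of distance \<open>0\<close> acquire
  distance at least \<open>1\<close>.
\<close>
lemma preserves_nearness_imp_cofinally_complete:
  fixes X :: "'a metric"
  assumes "hosts_points_of TYPE('b) X"
    and pres: "\<And>Y :: 'b metric. continuous_preserves_nearness_to_AC X Y"
  shows "cofinally_complete X"
proof (rule ccontr)
  assume "\<not> cofinally_complete X"
  then obtain A B where AB: "A \<in> AC X" "B \<noteq> {}" "closedin (mtopology_of X) B" "A \<inter> B = {}" "mgap X A B = 0"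
    using AC_witness_if_not_cofinally_complete by blast
  obtain \<iota> :: "'a \<Rightarrow> 'b" where \<iota>: "inj_on \<iota> (mspace X)"
    using assms(1) by (auto simp: hosts_points_of_def)
  have A: "closedin (mtopology_of X) A" "A \<noteq> {}" using AB(1) by (auto simp: AC_def)
  obtain Y :: "'b metric" where Y: "continuous_map (mtopology_of X) (mtopology_of Y) \<iota>"
    "\<And>a b. a \<in> A \<Longrightarrow> b \<in> B \<Longrightarrow> mdist Y (\<iota> a) (\<iota> b) \<ge> 1"
    using separating_remetrization[OF \<iota> A(1) AB(3,4)] by blast
  have "B \<subseteq> mspace X" using closedin_subset[OF AB(3)] by simp
  then have "mgap Y (\<iota> ` A) (\<iota> ` B) = 0"
    using pres[of Y] Y(1) AB unfolding continuous_preserves_nearness_to_AC_def by simp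
  then have "\<forall>\<epsilon>>0. \<exists>u\<in>\<iota> ` A. \<exists>v\<in>\<iota> ` B. mdist Y u v < \<epsilon>"
    using A(2) AB(2) by (simp only: mgap_eq_0_iff image_is_empty not_False_eq_True)
  then have "\<exists>u\<in>\<iota> ` A. \<exists>v\<in>\<iota> ` B. mdist Y u v < 1"
    by simp
  then obtain a b where "a \<in> A" "b \<in> B" "mdist Y (\<iota> a) (\<iota> b) < 1"
    by (elim bexE imageE) simp
  with Y(2)[of a b] show False by simp
qed

theorem theorem10:
  fixes X :: "'a metric"
  assumes "hosts_points_of TYPE('b) X"
  shows "(cofinally_complete X \<longleftrightarrow>
            (\<forall>Y :: 'b metric. continuous_strongly_uniform_on_AC X Y)) \<and>
         (cofinally_complete X \<longleftrightarrow>
            (\<forall>Y :: 'b metric. continuous_preserves_nearness_to_AC X Y)) \<and>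
         (cofinally_complete X \<longrightarrow>
            (\<forall>Z :: 'c metric. continuous_strongly_uniform_on_AC X Z \<and>
                              continuous_preserves_nearness_to_AC X Z))"
proof -
  let ?b = "\<forall>Y :: 'b metric. continuous_strongly_uniform_on_AC X Y"
  let ?c = "\<forall>Y :: 'b metric. continuous_preserves_nearness_to_AC X Y"
  have a_b: ?b if "cofinally_complete X"
    by (intro allI cofinally_complete_imp_strongly_uniform that)
  have b_c: ?c if ?b
    by (intro allI strongly_uniform_imp_preserves_nearness that[rule_format])
  have c_a: "cofinally_complete X" if ?c
    by (rule preserves_nearness_imp_cofinally_complete[OF assms that[rule_format]])
  have a_Z: "\<forall>Z :: 'c metric. continuous_strongly_uniform_on_AC X Z \<and>
                continuous_preserves_nearness_to_AC X Z" if "cofinally_complete X"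
    by (intro allI conjI strongly_uniform_imp_preserves_nearness
        cofinally_complete_imp_strongly_uniform that)
  show ?thesis
    by (intro conjI iffI impI; (assumption | rule a_b b_c c_a a_Z)+)
qed

end
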